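(* Let $\rho=(\sqrt5-1)/2$ be the inverse of the golden mean and let $\mu$ be the biased Bernoulli convolution arising from the IFS $\{\rho x,\ \rho x+1-\rho\}$ with probabilities $p,\,1-p$ respectively, where $1/2<p<1$. Then $\mu$ is an equicontractive, self-similar measure of finite type with support $[0,1]$, but $\dim_{qA}\mu=\infty$.
   Context: $\mu$ is the unique Borel probability measure on $\mathbb{R}$ with $\mu(E)=p\,\mu(S_0^{-1}(E))+(1-p)\,\mu(S_1^{-1}(E))$ for all Borel $E$, where $S_0(x)=\rho x$, $S_1(x)=\rho x+1-\rho$; its support is the unique non-empty compact set $K$ with $K=S_0(K)\cup S_1(K)$. For a word $w=(j_1,\dots,j_n)$, $S_w=S_{j_1}\circ\cdots\circ S_{j_n}$. An equicontractive IFS $\{S_j\}$ on $\mathbb{R}$ with contraction factor $r\in(0,1)$ and self-similar set of diameter $c$ (and any associated self-similar measure) is of finite type if there is a finite set $F\subseteq\mathbb{R}$ such that whenever $v,w$ are words of the same length $n$, either $|S_v(0)-S_w(0)|>c\,r^n$ or $r^{-n}|S_v(0)-S_w(0)|\in F$. For $\Phi:(0,1)\to[0,\infty)$, $\overline{\dim}_\Phi\mu$ is the infimum of all $\alpha$ for which there exist $C_1,C_2>0$ such that for all $0<r<R^{1+\Phi(R)}\le R\le C_1$ and all $x\in\mathrm{supp}\,\mu$, $\mu(B(x,R))/\mu(B(x,r))\le C_2(R/r)^\alpha$ (open balls). With $\Phi_\theta$ the constant function $1/\theta-1$, $\theta\in(0,1)$, the upper quasi-Assouad dimension is $\dim_{qA}\mu=\lim_{\theta\to1}\overline{\dim}_{\Phi_\theta}\mu$.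 *)

theory Defs
  imports "HOL-Probability.Probability"
begin

definition equicontractive_ifs :: "'i set \<Rightarrow> ('i \<Rightarrow> real \<Rightarrow> real) \<Rightarrow> real \<Rightarrow> bool" where
  "equicontractive_ifs I S r \<longleftrightarrow>
     finite I \<and> I \<noteq> {} \<and> 0 < r \<and> r < 1 \<and>
     (\<forall>j\<in>I. \<forall>x y. dist (S j x) (S j y) = r * dist x y)"

definition is_attractor :: "'i set \<Rightarrow> ('i \<Rightarrow> real \<Rightarrow> real) \<Rightarrow> real set \<Rightarrow> bool" where
  "is_attractor I S K \<longleftrightarrow> compact K \<and> K \<noteq> {} \<and> K = (\<Union>j\<in>I. S j ` K)"

definition self_similar_set :: "'i set \<Rightarrow> ('i \<Rightarrow> real \<Rightarrow> real) \<Rightarrow> real set" where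
  "self_similar_set I S = (THE K. is_attractor I S K)"

lemma is_attractor_subset:
  assumes ifs: "equicontractive_ifs I S r" and K: "is_attractor I S K" and L: "is_attractor I S L"
  shows "K \<subseteq> L"
proof
  fix x assume x: "x \<in> K"
  have r: "0 < r" "r < 1" using ifs by (auto simp: equicontractive_ifs_def)
  have Lc: "closed L" "L \<noteq> {}" using L by (auto simp: is_attractor_def compact_imp_closed)
  obtain l where l: "l \<in> L" using Lc by blast
  have "bounded K" using K by (auto simp: is_attractor_def compact_imp_bounded)
  then obtain B where B: "\<And>y. y \<in> K \<Longrightarrow> dist l y \<le> B"
    using bounded_any_center[of K l] by blast
  have bd: "infdist y L \<le> r ^ n * B" if "y \<in> K" for y n
    using that
  proof (induction n arbitrary: y)
    case 0
    then show ?case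
      using infdist_le[OF l, of y] B[of y] by (simp add: dist_commute)
  next
    case (Suc n)
    from Suc.prems K obtain j z where jz: "j \<in> I" "z \<in> K" "y = S j z"
      unfolding is_attractor_def by blast
    obtain m where m: "m \<in> L" "infdist z L = dist z m"
      using infdist_attains_inf[OF Lc] by blast
    have "S j m \<in> L" using L jz(1) m(1) unfolding is_attractor_def by blast
    then have "infdist y L \<le> dist (S j z) (S j m)" using infdist_le jz(3) by blast
    also have "\<dots> = r * infdist z L"
      using ifs jz(1) m(2) by (simp add: equicontractive_ifs_def)
    also have "\<dots> \<le> r * (r ^ n * B)"
      using Suc.IH[OF jz(2)] r by (intro mult_left_mono) auto
    finally show ?case by (simp add: mult.assoc)
  qed
  have "(\<lambda>n. r ^ n * B) \<longlonglongrightarrow> 0 * B"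
    using r by (intro tendsto_mult LIMSEQ_power_zero tendsto_const) auto
  then have "infdist x L \<le> 0"
    using bd[OF x] by (intro LIMSEQ_le_const[of "\<lambda>n. r ^ n * B"]) auto
  then have "infdist x L = 0" using infdist_nonneg[of x L] by linarith
  then show "x \<in> L" using in_closed_iff_infdist_zero[OF Lc] by blast
qed

lemma self_similar_set_eqI:
  assumes "equicontractive_ifs I S r" and "is_attractor I S K"
  shows "self_similar_set I S = K"
  unfolding self_similar_set_def
  using assms(2) is_attractor_subset[OF assms(1)] by (intro the_equality) blast+

text \<open>\<open>foldr S [j\<^sub>1, \<dots>, j\<^sub>n]\<close> is the composition \<open>S j\<^sub>1 \<circ> \<dots> \<circ> S j\<^sub>n\<close>.\<close>

definition finite_type :: "'i set \<Rightarrow> ('i \<Rightarrow> real \<Rightarrow> real) \<Rightarrow> real \<Rightarrow> bool" where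
  "finite_type I S r \<longleftrightarrow> equicontractive_ifs I S r \<and>
     (\<exists>F. finite F \<and>
       (\<forall>n. \<forall>v\<in>lists I. \<forall>w\<in>lists I. length v = n \<and> length w = n \<longrightarrow>
          \<bar>foldr S v 0 - foldr S w 0\<bar> > diameter (self_similar_set I S) * r ^ n \<or>
          \<bar>foldr S v 0 - foldr S w 0\<bar> / r ^ n \<in> F))"

definition self_similar_measure ::
  "'i set \<Rightarrow> ('i \<Rightarrow> real \<Rightarrow> real) \<Rightarrow> ('i \<Rightarrow> real) \<Rightarrow> real measure \<Rightarrow> bool" where
  "self_similar_measure I S P \<mu> \<longleftrightarrow>
     prob_space \<mu> \<and> sets \<mu> = sets borel \<and>
     (\<forall>j\<in>I. 0 < P j) \<and> sum P I = 1 \<and>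
     (\<forall>E\<in>sets borel. measure \<mu> E = (\<Sum>j\<in>I. P j * measure \<mu> (S j -` E)))"

definition measure_support :: "real measure \<Rightarrow> real set" where
  "measure_support \<mu> = {x. \<forall>U. open U \<and> x \<in> U \<longrightarrow> emeasure \<mu> U > 0}"

text \<open>
  The infimum is taken in the extended reals, so that it is \<open>\<infinity>\<close> when no exponent is admissible.
  Since \<open>\<Phi>\<close> only matters on \<open>(0,1)\<close>, the larger radius is restricted to that interval.
\<close>

definition upper_Phi_dim :: "(real \<Rightarrow> real) \<Rightarrow> real measure \<Rightarrow> ereal" where
  "upper_Phi_dim \<Phi> \<mu> = Inf (ereal ` {\<alpha>. \<exists>C1>0. \<exists>C2>0. \<forall>r R x.
     R \<in> {0<..<1} \<and> 0 < r \<and> r < R powr (1 + \<Phi> R) \<and> R powr (1 + \<Phi> R) \<le> R \<and> R \<le> C1 \<and>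
     x \<in> measure_support \<mu> \<longrightarrow>
     measure \<mu> (ball x R) / measure \<mu> (ball x r) \<le> C2 * (R / r) powr \<alpha>})"

definition upper_qA_dim :: "real measure \<Rightarrow> ereal" where
  "upper_qA_dim \<mu> = Lim (at_left 1) (\<lambda>\<theta>. upper_Phi_dim (\<lambda>_. 1 / \<theta> - 1) \<mu>)"

lemma upper_Phi_dim_mono:
  assumes "0 < s" "s \<le> t" "t < (1::real)"
  shows "upper_Phi_dim (\<lambda>_. 1 / s - 1) \<mu> \<le> upper_Phi_dim (\<lambda>_. 1 / t - 1) \<mu>"
proof -
  have st: "1 \<le> 1 / t" "1 / t \<le> 1 / s" using assms by (auto simp: field_simps)
  have le: "R powr (1 / s) \<le> R powr (1 / t)" "R powr (1 / t) \<le> R"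
    if "0 < R" "R < 1" for R :: real
    using that st powr_mono'[of "1 / t" "1 / s" R] powr_mono'[of 1 "1 / t" R] by auto
  have sub: "r < R powr (1 + (1 / t - 1)) \<and> R powr (1 + (1 / t - 1)) \<le> R"
    if "R \<in> {0<..<1}" "r < R powr (1 + (1 / s - 1))" for r R :: real
    using le[of R] that by auto
  show ?thesis
    unfolding upper_Phi_dim_def
    by (rule Inf_superset_mono, rule image_mono, rule Collect_mono) (metis sub)
qed

text \<open>The limit defining the upper quasi-Assouad dimension always exists.\<close>

lemma tendsto_upper_qA_dim:
  "((\<lambda>\<theta>. upper_Phi_dim (\<lambda>_. 1 / \<theta> - 1) \<mu>) \<longlongrightarrow> upper_qA_dim \<mu>) (at_left 1)"
proof -
  define f where "f \<theta> = upper_Phi_dim (\<lambda>_. 1 / \<theta> - 1) \<mu>" for \<theta> :: real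
  have ev: "\<forall>\<^sub>F \<theta> in at_left 1. \<theta> \<in> {a<..<1}" if "a < 1" for a :: real
    using that by (rule eventually_at_leftI[rotated]) auto
  have "(f \<longlongrightarrow> (SUP \<theta>\<in>{0<..<1}. f \<theta>)) (at_left 1)"
  proof (rule increasing_tendsto)
    show "\<forall>\<^sub>F \<theta> in at_left 1. f \<theta> \<le> (SUP \<theta>\<in>{0<..<1}. f \<theta>)"
      using ev[of 0] by (auto elim!: eventually_mono intro!: SUP_upper)
  next
    fix y assume "y < (SUP \<theta>\<in>{0<..<1}. f \<theta>)"
    then obtain s where s: "0 < s" "s < 1" "y < f s" by (auto simp: less_SUP_iff)
    show "\<forall>\<^sub>F \<theta> in at_left 1. y < f \<theta>"
      using ev[OF s(2)]
    proof eventually_elim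
      case (elim \<theta>)
      then have "f s \<le> f \<theta>"
        unfolding f_def using s by (intro upper_Phi_dim_mono) auto
      then show ?case using s(3) by (rule less_le_trans[rotated])
    qed
  qed
  then have "(f \<longlongrightarrow> Lim (at_left 1) f) (at_left 1)"
    by (metis tendsto_Lim trivial_limit_at_left_real)
  then show ?thesis
    by (simp add: upper_qA_dim_def f_def[abs_def])
qed

end

theory Submission
  imports Defs
begin

text \<open>
  Everything happens at the point \<open>1 - \<rho> = \<rho>\<^sup>2 = S\<^sub>1(0)\<close>, where the two sides carry
  masses of different exponential order. To its right lies a copy of the right-hand neighbourhood
  of \<open>0\<close>, and \<open>[0, \<rho>\<^sup>n]\<close> has mass at least \<open>p\<^sup>n\<close>
  (\<open>prob_right_of_S1_0\<close>). The mass on its left comes from \<open>S\<^sub>0\<close> alone, and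
  \<open>S\<^sub>0\<close> pulls \<open>\<rho>\<^sup>2\<close> back to \<open>\<rho>\<close>. At \<open>\<rho>\<close> both maps contribute: \<open>S\<^sub>0\<close> a copy
  of the left-hand neighbourhood of \<open>1\<close>, whose mass decays like \<open>(1 - p)\<^sup>n\<close>, and \<open>S\<^sub>1\<close> the
  left-hand neighbourhood of \<open>\<rho>\<^sup>2\<close> once more. Two steps thus reproduce the left-hand mass
  with weight \<open>p (1 - p)\<close>, and since this exceeds \<open>(1 - p)\<^sup>2\<close>, the mass within distance \<open>\<rho>\<^sup>2\<^sup>k\<close>
  on the left is at most of order \<open>(p (1 - p))\<^sup>k\<close> (\<open>prob_left_of_S1_0\<close>).

  A ball centred slightly to the left of \<open>\<rho>\<^sup>2\<close> that reaches across it is therefore heavier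
  than any concentric ball that stays on the left, by a factor of order at least \<open>(p / (1 - p))\<^sup>k\<close>. This is
  a fixed positive power of \<open>1 / R\<close> when \<open>R\<close> is comparable to \<open>\<rho>\<^sup>2\<^sup>k\<close>. If \<open>r\<close> is comparable to
  \<open>R powr (1 + c)\<close>, then \<open>(R / r) powr \<alpha>\<close> is comparable to \<open>R powr (- \<alpha> c)\<close>, so an
  admissible \<open>\<alpha>\<close> is at least a positive constant over \<open>c\<close> (\<open>admissible_exponent_ge\<close>). With
  \<open>c = 1 / \<theta> - 1\<close> this tends to \<open>\<infinity>\<close> as \<open>\<theta> \<rightarrow> 1\<close>.

  Finite type is the Pisot property of the golden mean. Normalised differences of words are
  elements \<open>a + b \<rho>\<close> of \<open>\<int>[\<rho>]\<close> whose algebraic conjugates stay bounded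
  (\<open>word_difference_conjugate_bounded\<close>), and only finitely many such elements are bounded
  themselves.
\<close>

section \<open>Arithmetic of the inverse golden mean\<close>

lemma inverse_golden_mean:
  fixes \<rho> :: real
  assumes "\<rho> = (sqrt 5 - 1) / 2"
  shows "\<rho>\<^sup>2 = 1 - \<rho>" and "1 / 2 < \<rho>" and "\<rho> < 2 / 3"
proof -
  have "(sqrt 5)\<^sup>2 = (5::real)" by simp
  then show "\<rho>\<^sup>2 = 1 - \<rho>"
    unfolding assms by (simp add: power_divide power2_diff field_simps)
  have "2 < sqrt (5::real)" by (rule real_less_rsqrt) simp
  then show "1 / 2 < \<rho>" using assms by simp
  have "sqrt (5::real) < 7 / 3" by (rule real_less_lsqrt) (auto simp: power2_eq_square)
  then show "\<rho> < 2 / 3" using assms by simp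
qed

text \<open>
  The conjugate of \<open>\<rho>\<close> is \<open>- 1 - \<rho> = - 1 / \<rho>\<close>. Hence \<open>1 - \<rho> = \<rho>\<^sup>2\<close> divided by a power of \<open>\<rho>\<close>,
  which grows, is an element of \<open>\<int>[\<rho>]\<close> whose conjugate decays. It is the contribution of one
  letter to the normalised translation of a word.
\<close>
lemma inverse_power_golden_conjugates:
  fixes \<rho> :: real
  assumes "\<rho> = (sqrt 5 - 1) / 2"
  shows "\<exists>(a::int) (b::int). (1 - \<rho>) / \<rho> ^ Suc n = a + b * \<rho> \<and>
           (- \<rho>) ^ n / (- \<rho>) = a + b * (- 1 - \<rho>)"
proof (induction n)
  case 0
  note r = inverse_golden_mean[OF assms]
  have "(1 - \<rho>) / \<rho> ^ Suc 0 = \<rho>" "1 / (- \<rho>) = - 1 - \<rho>"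
    using r by (auto simp: field_simps power2_eq_square)
  then show ?case by (intro exI[of _ "0::int"] exI[of _ "1::int"]) simp
next
  case (Suc n)
  note r = inverse_golden_mean[OF assms]
  obtain a b :: int where ab: "(1 - \<rho>) / \<rho> ^ Suc n = a + b * \<rho>"
      "(- \<rho>) ^ n / (- \<rho>) = a + b * (- 1 - \<rho>)"
    using Suc by blast
  have inv: "1 / \<rho> = 1 + \<rho>" using r by (simp add: field_simps power2_eq_square)
  have "(1 - \<rho>) / \<rho> ^ Suc (Suc n) = (a + b * \<rho>) * (1 + \<rho>)"
    using ab(1) inv by (metis divide_divide_eq_left mult.commute power_Suc times_divide_eq_right mult.right_neutral)
  also have "\<dots> = a + a * \<rho> + b * \<rho> + b * \<rho>\<^sup>2" by (simp add: algebra_simps power2_eq_square)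
  also have "\<dots> = of_int (a + b) + of_int a * \<rho>" unfolding r(1) by (simp add: algebra_simps)
  finally have 1: "(1 - \<rho>) / \<rho> ^ Suc (Suc n) = of_int (a + b) + of_int a * \<rho>" .
  have "(- \<rho>) ^ Suc n / (- \<rho>) = (- \<rho>) * (a + b * (- 1 - \<rho>))"
    using ab(2) by (metis power_Suc times_divide_eq_right)
  also have "\<dots> = - a * \<rho> + b * \<rho> + b * \<rho>\<^sup>2" by (simp add: algebra_simps power2_eq_square)
  also have "\<dots> = of_int (a + b) + of_int a * (- 1 - \<rho>)" unfolding r(1) by (simp add: algebra_simps)
  finally show ?case using 1 by blast
qed

section \<open>The iterated function system\<close>

text \<open>
  Prepending a letter to both words adds \<open>-1\<close>, \<open>0\<close> or \<open>1\<close> times the next number of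
  \<open>inverse_power_golden_conjugates\<close>. Its conjugate has modulus \<open>\<rho>\<^sup>n / \<rho>\<close>,
  and the bound is the partial sum of this geometric series, in closed form because
  \<open>\<rho> (1 - \<rho>)\<close> is the cube of \<open>\<rho>\<close>.
\<close>
lemma word_difference_conjugate_bounded:
  fixes \<rho> :: real and S :: "nat \<Rightarrow> real \<Rightarrow> real"
  assumes \<rho>: "\<rho> = (sqrt 5 - 1) / 2"
    and S: "S 0 = (\<lambda>x. \<rho> * x)" "S 1 = (\<lambda>x. \<rho> * x + 1 - \<rho>)"
    and "v \<in> lists {0, 1}" "w \<in> lists {0, 1}" "length v = n" "length w = n"
  shows "\<exists>(a::int) (b::int). (foldr S v 0 - foldr S w 0) / \<rho> ^ n = a + b * \<rho> \<and>
           \<bar>a + b * (- 1 - \<rho>)\<bar> \<le> (1 - \<rho> ^ n) / \<rho> ^ 3"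
  using assms(4-)
proof (induction n arbitrary: v w)
  case 0
  then show ?case by (intro exI[of _ "0::int"]) simp
next
  case (Suc n)
  note r = inverse_golden_mean[OF \<rho>]
  obtain j v' k w' where v: "v = j # v'" and w: "w = k # w'"
    using Suc.prems by (auto simp: length_Suc_conv)
  have jk: "j \<in> {0, 1}" "k \<in> {0, 1}" using Suc.prems v w by auto
  obtain a b :: int where ab: "(foldr S v' 0 - foldr S w' 0) / \<rho> ^ n = a + b * \<rho>"
      "\<bar>a + b * (- 1 - \<rho>)\<bar> \<le> (1 - \<rho> ^ n) / \<rho> ^ 3"
    using Suc.IH[of v' w'] Suc.prems v w by auto
  obtain c d :: int where cd: "(1 - \<rho>) / \<rho> ^ Suc n = c + d * \<rho>"
      "(- \<rho>) ^ n / (- \<rho>) = c + d * (- 1 - \<rho>)"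
    using inverse_power_golden_conjugates[OF \<rho>] by blast
  define e :: int where "e = int j - int k"
  have e: "\<bar>e\<bar> \<le> 1" using jk by (auto simp: e_def)
  have Sj: "S i x = \<rho> * x + i * (1 - \<rho>)" if "i \<in> {0, 1}" for i x
    using that S by (auto simp: algebra_simps)
  have "(foldr S v 0 - foldr S w 0) / \<rho> ^ Suc n
      = (foldr S v' 0 - foldr S w' 0) / \<rho> ^ n + e * ((1 - \<rho>) / \<rho> ^ Suc n)"
    using r(2) unfolding v w by (simp add: Sj[OF jk(1)] Sj[OF jk(2)] e_def field_simps)
  also have "\<dots> = of_int (a + e * c) + of_int (b + e * d) * \<rho>"
    unfolding ab(1) cd(1) by (simp add: algebra_simps)
  finally have 1: "(foldr S v 0 - foldr S w 0) / \<rho> ^ Suc n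
      = of_int (a + e * c) + of_int (b + e * d) * \<rho>" .
  have "\<bar>of_int (a + e * c) + of_int (b + e * d) * (- 1 - \<rho>)\<bar>
      = \<bar>(a + b * (- 1 - \<rho>)) + e * ((- \<rho>) ^ n / (- \<rho>))\<bar>"
    unfolding cd(2) by (simp add: algebra_simps)
  also have "\<dots> \<le> \<bar>a + b * (- 1 - \<rho>)\<bar> + \<bar>e * ((- \<rho>) ^ n / (- \<rho>))\<bar>" by (rule abs_triangle_ineq)
  also have "\<dots> \<le> (1 - \<rho> ^ n) / \<rho> ^ 3 + \<rho> ^ n / \<rho>"
  proof (rule add_mono[OF ab(2)])
    have "\<bar>e * ((- \<rho>) ^ n / (- \<rho>))\<bar> \<le> 1 * (\<rho> ^ n / \<rho>)"
      unfolding abs_mult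
      using e r(2) by (intro mult_mono) (auto simp: power_abs abs_divide)
    then show "\<bar>e * ((- \<rho>) ^ n / (- \<rho>))\<bar> \<le> \<rho> ^ n / \<rho>" by simp
  qed
  also have "\<dots> = (1 - \<rho> ^ n * (1 - \<rho>\<^sup>2)) / \<rho> ^ 3"
    using r(2) by (simp add: field_simps power2_eq_square power3_eq_cube)
  also have "\<dots> = (1 - \<rho> ^ Suc n) / \<rho> ^ 3" using r(1) by simp
  finally show ?case using 1 by blast
qed

lemma golden_ifs_equicontractive:
  fixes \<rho> :: real and S :: "nat \<Rightarrow> real \<Rightarrow> real"
  assumes \<rho>: "\<rho> = (sqrt 5 - 1) / 2"
    and S: "S 0 = (\<lambda>x. \<rho> * x)" "S 1 = (\<lambda>x. \<rho> * x + 1 - \<rho>)"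
  shows "equicontractive_ifs {0, 1} S \<rho>"
proof -
  note r = inverse_golden_mean[OF \<rho>]
  have "dist (\<rho> * x) (\<rho> * y) = \<rho> * dist x y" for x y
    using r(2) by (simp add: dist_real_def right_diff_distrib[symmetric] abs_mult)
  then show ?thesis using r S by (simp add: equicontractive_ifs_def dist_real_def)
qed

lemma golden_ifs_attractor:
  fixes \<rho> :: real and S :: "nat \<Rightarrow> real \<Rightarrow> real"
  assumes \<rho>: "\<rho> = (sqrt 5 - 1) / 2"
    and S: "S 0 = (\<lambda>x. \<rho> * x)" "S 1 = (\<lambda>x. \<rho> * x + 1 - \<rho>)"
  shows "self_similar_set {0, 1} S = {0..1}"
proof -
  note r = inverse_golden_mean[OF \<rho>]
  have "S 0 ` {0..1} = {0..\<rho>}" using r(2) by (simp add: S)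
  moreover have "S 1 ` {0..1} = {1 - \<rho>..1}"
    using r(2) image_affinity_atLeastAtMost[of \<rho> "1 - \<rho>" 0 1] by (simp add: S(2)[simplified] add_diff_eq)
  ultimately have "{0..1} = (\<Union>j\<in>{0, 1}. S j ` {0..1})"
    using r by auto
  then have "is_attractor {0, 1} S {0..1}" by (simp add: is_attractor_def)
  then show ?thesis
    by (rule self_similar_set_eqI[OF golden_ifs_equicontractive[OF assms]])
qed

text \<open>
  A number \<open>a + b \<rho>\<close> and its conjugate differ by \<open>b (1 + 2 \<rho>)\<close>, so if both are bounded then so
  is \<open>b\<close>, and with it \<open>a\<close>. The conjugate is at most \<open>8\<close> because \<open>\<rho> > 1 / 2\<close>.
\<close>
lemma golden_ifs_finite_type:
  fixes \<rho> :: real and S :: "nat \<Rightarrow> real \<Rightarrow> real"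
  assumes \<rho>: "\<rho> = (sqrt 5 - 1) / 2"
    and S: "S 0 = (\<lambda>x. \<rho> * x)" "S 1 = (\<lambda>x. \<rho> * x + 1 - \<rho>)"
  shows "finite_type {0, 1} S \<rho>"
proof -
  note r = inverse_golden_mean[OF \<rho>]
  define F where "F = (\<lambda>(a, b). \<bar>real_of_int a + real_of_int b * \<rho>\<bar>) ` ({-11..11} \<times> {-10..10})"
  have "\<bar>foldr S v 0 - foldr S w 0\<bar> / \<rho> ^ n \<in> F"
    if vw: "v \<in> lists {0, 1}" "w \<in> lists {0, 1}" "length v = n" "length w = n"
      and close: "\<bar>foldr S v 0 - foldr S w 0\<bar> \<le> \<rho> ^ n" for v w n
  proof -
    obtain a b :: int where ab: "(foldr S v 0 - foldr S w 0) / \<rho> ^ n = a + b * \<rho>"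
        "\<bar>a + b * (- 1 - \<rho>)\<bar> \<le> (1 - \<rho> ^ n) / \<rho> ^ 3"
      using word_difference_conjugate_bounded[OF assms vw] by blast
    have eq: "\<bar>foldr S v 0 - foldr S w 0\<bar> / \<rho> ^ n = \<bar>a + b * \<rho>\<bar>"
      unfolding ab(1)[symmetric] using r(2) by (simp add: abs_divide)
    have le1: "\<bar>a + b * \<rho>\<bar> \<le> 1"
      unfolding eq[symmetric] using close r(2) by simp
    have "(1/2)^3 \<le> \<rho> ^ 3" using r(2) by (intro power_mono) auto
    then have "(1 - \<rho> ^ n) / \<rho> ^ 3 \<le> 1 / (1/2)^3"
      using r(2) by (intro frac_le) auto
    then have le8: "\<bar>a + b * (- 1 - \<rho>)\<bar> \<le> 8" using ab(2) by (simp add: power3_eq_cube)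
    have "\<bar>b * (1 + 2 * \<rho>)\<bar> = \<bar>(a + b * \<rho>) - (a + b * (- 1 - \<rho>))\<bar>"
      by (simp add: algebra_simps)
    also have "\<dots> \<le> 9" using le1 le8 by linarith
    finally have "\<bar>real_of_int b\<bar> * (1 + 2 * \<rho>) \<le> 9" using r(2) by (simp add: abs_mult)
    moreover have "\<bar>real_of_int b\<bar> * 1 \<le> \<bar>real_of_int b\<bar> * (1 + 2 * \<rho>)"
      using r(2) by (intro mult_left_mono) auto
    ultimately have b: "\<bar>real_of_int b\<bar> \<le> 9" by linarith
    have "\<bar>b * \<rho>\<bar> \<le> 9 * 1" unfolding abs_mult using b r by (intro mult_mono) auto
    then have a: "\<bar>real_of_int a\<bar> \<le> 10" using le1 by linarith
    have "a \<in> {-11..11}" "b \<in> {-10..10}" using a b by auto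
    then show ?thesis unfolding eq F_def by force
  qed
  then have "\<forall>n. \<forall>v\<in>lists {0, 1}. \<forall>w\<in>lists {0, 1}. length v = n \<and> length w = n \<longrightarrow>
      \<bar>foldr S v 0 - foldr S w 0\<bar> > 1 * \<rho> ^ n \<or> \<bar>foldr S v 0 - foldr S w 0\<bar> / \<rho> ^ n \<in> F"
    by (metis mult_1 not_le)
  moreover have "finite F" by (simp add: F_def)
  moreover have "diameter {0..1::real} = 1" by simp
  ultimately show ?thesis
    unfolding finite_type_def golden_ifs_attractor[OF assms]
    using golden_ifs_equicontractive[OF assms] by metis
qed

section \<open>Mass distribution of the biased convolution\<close>

locale biased_golden_convolution = prob_space \<mu> for \<mu> :: "real measure" +
  fixes \<rho> p :: real
  assumes golden: "\<rho> = (sqrt 5 - 1) / 2"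
    and bias: "1 / 2 < p" "p < 1"
    and borel_sets: "sets \<mu> = sets borel"
    and self_similar: "E \<in> sets borel \<Longrightarrow>
      prob E = p * prob ((\<lambda>x. \<rho> * x) -` E) + (1 - p) * prob ((\<lambda>x. \<rho> * x + 1 - \<rho>) -` E)"
begin

lemmas rho = inverse_golden_mean[OF golden]

lemma rho_pos: "0 < \<rho>" and rho_less_1: "\<rho> < 1"
  using rho by auto

lemma space_UNIV: "space \<mu> = UNIV"
  using sets_eq_imp_space_eq[OF borel_sets] by simp

lemma prob_mono: "A \<subseteq> B \<Longrightarrow> B \<in> sets borel \<Longrightarrow> prob A \<le> prob B"
  by (rule finite_measure_mono) (auto simp: borel_sets)

lemma borel_vimage_contractions:
  assumes "E \<in> sets borel"
  shows "(\<lambda>x. \<rho> * x) -` E \<in> sets borel" "(\<lambda>x. \<rho> * x + 1 - \<rho>) -` E \<in> sets borel"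
  using measurable_sets_borel[of "\<lambda>x. \<rho> * x" borel E]
    measurable_sets_borel[of "\<lambda>x. \<rho> * x + 1 - \<rho>" borel E] assms by auto

lemma prob_lower_0:
  assumes "E \<in> sets borel" "(\<And>x. x \<in> A \<Longrightarrow> \<rho> * x \<in> E)"
  shows "p * prob A \<le> prob E"
proof -
  have "prob A \<le> prob ((\<lambda>x. \<rho> * x) -` E)"
    using assms borel_vimage_contractions by (intro prob_mono) auto
  then have "p * prob A \<le> p * prob ((\<lambda>x. \<rho> * x) -` E)" using bias by simp
  moreover have "0 \<le> (1 - p) * prob ((\<lambda>x. \<rho> * x + 1 - \<rho>) -` E)" using bias by simp
  ultimately show ?thesis unfolding self_similar[OF assms(1)] by linarith
qed

lemma prob_lower_1:
  assumes "E \<in> sets borel" "(\<And>x. x \<in> A \<Longrightarrow> \<rho> * x + 1 - \<rho> \<in> E)"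
  shows "(1 - p) * prob A \<le> prob E"
proof -
  have "prob A \<le> prob ((\<lambda>x. \<rho> * x + 1 - \<rho>) -` E)"
    using assms borel_vimage_contractions by (intro prob_mono) auto
  then have "(1 - p) * prob A \<le> (1 - p) * prob ((\<lambda>x. \<rho> * x + 1 - \<rho>) -` E)" using bias by simp
  moreover have "0 \<le> p * prob ((\<lambda>x. \<rho> * x) -` E)" using bias by simp
  ultimately show ?thesis unfolding self_similar[OF assms(1)] by linarith
qed

lemma prob_upper:
  assumes "E \<in> sets borel" "A \<in> sets borel" "B \<in> sets borel"
    and "\<And>x. \<rho> * x \<in> E \<Longrightarrow> x \<in> A" "\<And>x. \<rho> * x + 1 - \<rho> \<in> E \<Longrightarrow> x \<in> B"
  shows "prob E \<le> p * prob A + (1 - p) * prob B"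
proof -
  have "(\<lambda>x. \<rho> * x) -` E \<subseteq> A" "(\<lambda>x. \<rho> * x + 1 - \<rho>) -` E \<subseteq> B"
    using assms(4,5) by auto
  then show ?thesis
    unfolding self_similar[OF assms(1)]
    using bias assms(2,3) by (intro add_mono mult_left_mono prob_mono) simp_all
qed

text \<open>
  Both maps pull a neighbourhood of \<open>[0, 1]\<close> back to a set containing the neighbourhood that is
  wider by \<open>1 / \<rho>\<close>. Iterating bounds the mass outside by that of sets decreasing to the
  empty set.
\<close>
lemma prob_outside_neighbourhood:
  assumes "0 < t"
  shows "prob (- {-t..1 + t}) = 0"
proof -
  have scale: "-s \<le> \<rho> * x \<and> \<rho> * x \<le> \<rho> + s" if "x \<in> {-(s / \<rho>)..1 + s / \<rho>}" for s x
    using that rho_pos by (simp add: field_simps)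
  have step: "prob (- {-s..1 + s}) \<le> prob (- {-(s / \<rho>)..1 + s / \<rho>})" if "0 < s" for s
  proof -
    have "prob (- {-s..1 + s}) \<le> p * prob (- {-(s / \<rho>)..1 + s / \<rho>})
        + (1 - p) * prob (- {-(s / \<rho>)..1 + s / \<rho>})"
    proof (rule prob_upper)
      fix x assume x: "\<rho> * x \<in> - {-s..1 + s}"
      show "x \<in> - {-(s / \<rho>)..1 + s / \<rho>}"
      proof
        assume "x \<in> {-(s / \<rho>)..1 + s / \<rho>}"
        from scale[OF this] show False using x that rho_less_1 by auto
      qed
    next
      fix x assume x: "\<rho> * x + 1 - \<rho> \<in> - {-s..1 + s}"
      show "x \<in> - {-(s / \<rho>)..1 + s / \<rho>}"
      proof
        assume "x \<in> {-(s / \<rho>)..1 + s / \<rho>}"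
        from scale[OF this] show False using x that rho_less_1 by auto
      qed
    qed auto
    then show ?thesis by (simp add: algebra_simps)
  qed
  have iter: "prob (- {-t..1 + t}) \<le> prob (- {-(t / \<rho> ^ n)..1 + t / \<rho> ^ n})" for n
  proof (induction n)
    case (Suc n)
    then show ?case
      using step[of "t / \<rho> ^ n"] assms rho_pos by (simp add: field_simps)
  qed simp
  define A where "A n = - {-(t / \<rho> ^ n)..1 + t / \<rho> ^ n}" for n
  have "(\<lambda>n. prob (A n)) \<longlonglongrightarrow> prob (\<Inter>n. A n)"
  proof (rule finite_Lim_measure_decseq)
    show "range A \<subseteq> sets \<mu>" by (auto simp: A_def borel_sets)
    have "t / \<rho> ^ n \<le> t / \<rho> ^ Suc n" for n
      using assms rho_pos rho_less_1 by (simp add: field_simps)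
    then show "decseq A"
      unfolding A_def by (intro decseq_SucI, subst Compl_subset_Compl_iff, subst atLeastatMost_subset_iff) auto
  qed
  moreover have "(\<Inter>n. A n) = {}"
  proof (rule ccontr)
    assume "(\<Inter>n. A n) \<noteq> {}"
    then obtain x where x: "\<And>n. x \<in> A n" by blast
    obtain n where "\<bar>x\<bar> / t < (1 / \<rho>) ^ n"
      using real_arch_pow[of "1 / \<rho>" "\<bar>x\<bar> / t"] rho_pos rho_less_1 by auto
    then have "\<bar>x\<bar> < t / \<rho> ^ n" using assms by (simp add: power_divide field_simps)
    then show False using x[of n] by (auto simp: A_def)
  qed
  ultimately have "(\<lambda>n. prob (A n)) \<longlonglongrightarrow> 0" by simp
  then have "prob (- {-t..1 + t}) \<le> 0"
    using iter by (intro LIMSEQ_le_const) (auto simp: A_def)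
  then show ?thesis using measure_nonneg[of \<mu>] by (simp add: order_antisym)
qed

lemma prob_outside: "prob (- {0..1}) = 0"
proof -
  define A where "A n = - {-(1 / real (Suc n))..1 + 1 / real (Suc n)}" for n
  have "emeasure \<mu> (\<Union>n. A n) = 0"
  proof (rule emeasure_UN_eq_0)
    show "emeasure \<mu> (A n) = 0" for n
      using prob_outside_neighbourhood[of "1 / real (Suc n)"]
      by (simp add: A_def emeasure_eq_measure)
  qed (auto simp: A_def borel_sets)
  then have "prob (\<Union>n. A n) = 0" by (simp add: emeasure_eq_measure)
  moreover have "- {0..1} \<subseteq> (\<Union>n. A n)"
  proof
    fix x :: real assume x: "x \<in> - {0..1}"
    then have "0 < max (- x) (x - 1)" by auto
    then obtain n where "1 / real (Suc n) < max (- x) (x - 1)"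
      using nat_approx_posE by blast
    then have "x \<in> A n" by (auto simp: A_def)
    then show "x \<in> (\<Union>n. A n)" by blast
  qed
  ultimately show ?thesis
    using prob_mono[of "- {0..1}" "\<Union>n. A n"] measure_nonneg[of \<mu> "- {0..1}"]
    by (force simp: A_def)
qed

lemma null_outside: "A \<inter> {0..1} = {} \<Longrightarrow> prob A = 0"
  using prob_mono[of A "- {0..1}"] prob_outside measure_nonneg[of \<mu> A] by force

lemma prob_unit_interval: "prob {0..1} = 1"
  using prob_compl[of "{0..1}"] prob_outside
  by (simp add: borel_sets space_UNIV Compl_eq_Diff_UNIV)

text \<open>
  Every \<open>x\<close> in \<open>[0, 1]\<close> is the image of some \<open>y\<close> in \<open>[0, 1]\<close>, and the map in question carries the
  ball around \<open>y\<close> onto the ball around \<open>x\<close> that is smaller by \<open>\<rho>\<close>; each map has weight at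
  least \<open>1 - p\<close>.
\<close>
lemma prob_cball_ge:
  assumes "x \<in> {0..1}"
  shows "(1 - p) ^ n \<le> prob (cball x (\<rho> ^ n))"
  using assms
proof (induction n arbitrary: x)
  case 0
  have "prob {0..1} \<le> prob (cball x 1)"
    using 0 by (intro prob_mono) (auto simp: dist_real_def)
  then show ?case by (simp add: prob_unit_interval)
next
  case (Suc n)
  have IH: "(1 - p) * (1 - p) ^ n \<le> (1 - p) * prob (cball y (\<rho> ^ n))" if "y \<in> {0..1}" for y
    using Suc.IH[OF that] bias by simp
  have scale: "\<bar>\<rho> * y - \<rho> * z\<bar> \<le> \<rho> * \<rho> ^ n" if "\<bar>y - z\<bar> \<le> \<rho> ^ n" for y z
    using that rho_pos by (simp add: right_diff_distrib[symmetric] abs_mult)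
  show ?case
  proof (cases "x \<le> \<rho>")
    case True
    define y where "y = x / \<rho>"
    have y: "y \<in> {0..1}" "x = \<rho> * y" using True Suc.prems rho_pos by (auto simp: y_def)
    have "(1 - p) * prob (cball y (\<rho> ^ n)) \<le> p * prob (cball y (\<rho> ^ n))"
      using bias by (intro mult_right_mono) auto
    also have "\<dots> \<le> prob (cball x (\<rho> ^ Suc n))"
      unfolding y(2) by (rule prob_lower_0) (auto simp: dist_real_def scale)
    finally show ?thesis using IH[OF y(1)] by simp
  next
    case False
    define y where "y = (x - (1 - \<rho>)) / \<rho>"
    have y: "y \<in> {0..1}" "x = \<rho> * y + 1 - \<rho>"
      using False Suc.prems rho by (auto simp: y_def field_simps)
    have "(1 - p) * prob (cball y (\<rho> ^ n)) \<le> prob (cball x (\<rho> ^ Suc n))"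
      unfolding y(2) by (rule prob_lower_1) (auto simp: dist_real_def scale)
    then show ?thesis using IH[OF y(1)] by simp
  qed
qed

lemma support: "measure_support \<mu> = {0..1}"
proof
  show "measure_support \<mu> \<subseteq> {0..1}"
  proof
    fix x assume x: "x \<in> measure_support \<mu>"
    show "x \<in> {0..1}"
    proof (rule ccontr)
      assume "x \<notin> {0..1}"
      moreover have "open (- {0..1::real})" by auto
      ultimately have "emeasure \<mu> (- {0..1}) > 0"
        using x unfolding measure_support_def by blast
      then show False using prob_outside by (simp add: emeasure_eq_measure)
    qed
  qed
next
  show "{0..1} \<subseteq> measure_support \<mu>"
  proof
    fix x :: real assume x: "x \<in> {0..1}"
    have "0 < emeasure \<mu> U" if U: "open U" "x \<in> U" for U
    proof -
      obtain e where e: "0 < e" "cball x e \<subseteq> U"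
        using U open_contains_cball by blast
      obtain n where n: "\<rho> ^ n < e"
        using real_arch_pow_inv[OF e(1) rho_less_1] by blast
      have "0 < (1 - p) ^ n" using bias by simp
      also have "\<dots> \<le> prob (cball x (\<rho> ^ n))" by (rule prob_cball_ge[OF x])
      also have "\<dots> \<le> prob U" using e n U by (intro prob_mono) (force, auto)
      finally show ?thesis by (simp add: emeasure_eq_measure)
    qed
    then show "x \<in> measure_support \<mu>" by (auto simp: measure_support_def)
  qed
qed

lemma prob_right_of_0: "p ^ n \<le> prob {0..\<rho> ^ n}"
proof (induction n)
  case 0
  then show ?case by (simp add: prob_unit_interval)
next
  case (Suc n)
  have "p * p ^ n \<le> p * prob {0..\<rho> ^ n}" using Suc bias by simp
  also have "\<dots> \<le> prob {0..\<rho> ^ Suc n}"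
    using rho_pos by (intro prob_lower_0) auto
  finally show ?case by simp
qed

lemma prob_right_of_S1_0: "(1 - p) * p ^ n \<le> prob {1 - \<rho>..1 - \<rho> + \<rho> ^ Suc n}"
proof -
  have "(1 - p) * p ^ n \<le> (1 - p) * prob {0..\<rho> ^ n}"
    using prob_right_of_0 bias by simp
  also have "\<dots> \<le> prob {1 - \<rho>..1 - \<rho> + \<rho> ^ Suc n}"
    using rho_pos by (intro prob_lower_1) auto
  finally show ?thesis .
qed

text \<open>
  For these \<open>s\<close> the interval lies beyond \<open>S\<^sub>0(1) = \<rho>\<close>, so only \<open>S\<^sub>1\<close> puts mass on it.
\<close>
lemma prob_left_of_1_step:
  assumes "s \<le> 1 - \<rho>"
  shows "prob {1 - s<..<1} \<le> (1 - p) * prob {1 - s / \<rho><..<1}"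
proof -
  have "prob {1 - s<..<1} \<le> p * prob {1<..} + (1 - p) * prob {1 - s / \<rho><..<1}"
  proof (rule prob_upper)
    fix x assume "\<rho> * x \<in> {1 - s<..<1}"
    then have "\<rho> * 1 < \<rho> * x" using assms by simp
    then show "x \<in> {1<..}" using rho_pos by simp
  next
    fix x assume "\<rho> * x + 1 - \<rho> \<in> {1 - s<..<1}"
    then show "x \<in> {1 - s / \<rho><..<1}" using rho_pos by (simp add: field_simps)
  qed auto
  moreover have "prob {1<..} = 0" by (rule null_outside) auto
  ultimately show ?thesis by simp
qed

text \<open>
  The exponents advance by \<open>2\<close> to match the two steps that lead from \<open>1 - \<rho>\<close> back to itself, and
  start at \<open>2\<close> so that \<open>prob_left_of_1_step\<close>, which needs \<open>s \<le> \<rho>\<^sup>2\<close>, applies throughout.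
\<close>
lemma prob_left_of_1:
  "prob {1 - \<rho> ^ (2 * k + 2)<..<1} \<le> ((1 - p)\<^sup>2) ^ k"
proof (induction k)
  case 0
  then show ?case by simp
next
  case (Suc k)
  have le: "\<rho> ^ (m + 2) \<le> 1 - \<rho>" for m
    using rho_pos rho_less_1 unfolding rho(1)[symmetric]
    by (intro power_decreasing) auto
  have "prob {1 - \<rho> ^ (2 * Suc k + 2)<..<1} \<le> (1 - p) * prob {1 - \<rho> ^ (2 * k + 3)<..<1}"
    using prob_left_of_1_step[OF le[of "2 * Suc k"]] rho_pos by (simp add: field_simps numeral_3_eq_3)
  also have "prob {1 - \<rho> ^ (2 * k + 3)<..<1} \<le> (1 - p) * prob {1 - \<rho> ^ (2 * k + 2)<..<1}"
    using prob_left_of_1_step[OF le[of "2 * k + 1"]] rho_pos by (simp add: field_simps numeral_3_eq_3)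
  also have "\<dots> \<le> (1 - p) * ((1 - p)\<^sup>2) ^ k" using Suc bias by simp
  finally show ?case using bias by (simp add: power2_eq_square mult.assoc)
qed

text \<open>
  Left of \<open>1 - \<rho> = S\<^sub>1(0)\<close> the map \<open>S\<^sub>1\<close> puts no mass, and \<open>S\<^sub>0\<close> pulls the interval back to one
  ending at \<open>\<rho> = S\<^sub>0(1) = S\<^sub>1(1 - \<rho>)\<close>, which accounts for the two terms.
\<close>
lemma prob_left_of_S1_0_step:
  "prob {1 - \<rho> - s<..<1 - \<rho>} \<le> p\<^sup>2 * prob {1 - s / \<rho>\<^sup>2<..<1}
     + p * (1 - p) * prob {1 - \<rho> - s / \<rho>\<^sup>2<..<1 - \<rho>}"
proof -
  have "prob {1 - \<rho> - s<..<1 - \<rho>} \<le> p * prob {\<rho> - s / \<rho><..<\<rho>} + (1 - p) * prob {..<0}"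
  proof (rule prob_upper)
    fix x assume "\<rho> * x \<in> {1 - \<rho> - s<..<1 - \<rho>}"
    then have "\<rho> * x < \<rho> * \<rho>" "\<rho> * \<rho> - s < \<rho> * x"
      unfolding rho(1)[symmetric] by (auto simp: power2_eq_square)
    then show "x \<in> {\<rho> - s / \<rho><..<\<rho>}" using rho_pos by (simp add: field_simps)
  next
    fix x assume "\<rho> * x + 1 - \<rho> \<in> {1 - \<rho> - s<..<1 - \<rho>}"
    then show "x \<in> {..<0}" using rho_pos by (simp add: mult_less_0_iff)
  qed auto
  moreover have "prob {..<0} = 0" by (rule null_outside) auto
  ultimately have 1: "prob {1 - \<rho> - s<..<1 - \<rho>} \<le> p * prob {\<rho> - s / \<rho><..<\<rho>}" by simp
  have "prob {\<rho> - s / \<rho><..<\<rho>}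
      \<le> p * prob {1 - s / \<rho>\<^sup>2<..<1} + (1 - p) * prob {1 - \<rho> - s / \<rho>\<^sup>2<..<1 - \<rho>}"
  proof (rule prob_upper)
    fix x assume x: "\<rho> * x \<in> {\<rho> - s / \<rho><..<\<rho>}"
    have "\<rho> * (1 - s / \<rho>\<^sup>2) = \<rho> - s / \<rho>"
      using rho_pos by (simp add: right_diff_distrib power2_eq_square)
    then have "\<rho> * x < \<rho> * 1" "\<rho> * (1 - s / \<rho>\<^sup>2) < \<rho> * x" using x by auto
    then show "x \<in> {1 - s / \<rho>\<^sup>2<..<1}" using rho_pos by simp
  next
    fix x assume "\<rho> * x + 1 - \<rho> \<in> {\<rho> - s / \<rho><..<\<rho>}"
    then have "\<rho> * x < \<rho> - \<rho>\<^sup>2" "\<rho> - \<rho>\<^sup>2 - s / \<rho> < \<rho> * x"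
      unfolding rho(1) by auto
    then have "\<rho> * x < \<rho> * (1 - \<rho>)" "\<rho> * (1 - \<rho> - s / \<rho>\<^sup>2) < \<rho> * x"
      using rho_pos by (auto simp: algebra_simps power2_eq_square)
    then show "x \<in> {1 - \<rho> - s / \<rho>\<^sup>2<..<1 - \<rho>}" using rho_pos by simp
  qed auto
  then have "p * prob {\<rho> - s / \<rho><..<\<rho>} \<le> p *
      (p * prob {1 - s / \<rho>\<^sup>2<..<1} + (1 - p) * prob {1 - \<rho> - s / \<rho>\<^sup>2<..<1 - \<rho>})"
    using bias by (intro mult_left_mono) auto
  with 1 show ?thesis by (simp add: algebra_simps power2_eq_square)
qed

text \<open>
  The masses \<open>a\<^sub>k\<close> satisfy \<open>a\<^sub>k\<^sub>+\<^sub>1 \<le> p\<^sup>2 t\<^sup>k + q a\<^sub>k\<close> with \<open>t = (1 - p)\<^sup>2\<close> below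
  \<open>q = p (1 - p)\<close>, which is where \<open>p > 1 / 2\<close> enters; so the inhomogeneous term does not affect
  the order of growth.
\<close>
lemma prob_left_of_S1_0:
  "\<exists>A>0. \<forall>k. prob {1 - \<rho> - \<rho> ^ (2 * k + 2)<..<1 - \<rho>} \<le> A * (p * (1 - p)) ^ k"
proof -
  define q where "q = p * (1 - p)"
  define t where "t = (1 - p)\<^sup>2"
  define B where "B = p\<^sup>2 / (q - t)"
  have "q - t = (1 - p) * (2 * p - 1)" by (simp add: q_def t_def algebra_simps power2_eq_square)
  then have qt: "0 < q - t" using bias by simp
  have B: "0 \<le> B" "p\<^sup>2 + B * t = B * q" using qt by (auto simp: B_def field_simps)
  have t: "0 \<le> t" by (simp add: t_def)
  have q: "0 < q" using bias by (simp add: q_def)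
  \<comment> \<open>\<open>- B t\<^sup>k\<close> solves the recursion with equality, and adding a multiple of \<open>q\<^sup>k\<close> fits \<open>k = 0\<close>.\<close>
  have bound: "prob {1 - \<rho> - \<rho> ^ (2 * k + 2)<..<1 - \<rho>} \<le> (1 + B) * q ^ k - B * t ^ k" for k
  proof (induction k)
    case 0
    then show ?case by simp
  next
    case (Suc k)
    have div: "\<rho> ^ (2 * Suc k + 2) / \<rho>\<^sup>2 = \<rho> ^ (2 * k + 2)"
      using rho_pos by (simp add: field_simps power2_eq_square)
    have "prob {1 - \<rho> - \<rho> ^ (2 * Suc k + 2)<..<1 - \<rho>}
        \<le> p\<^sup>2 * prob {1 - \<rho> ^ (2 * k + 2)<..<1} + q * prob {1 - \<rho> - \<rho> ^ (2 * k + 2)<..<1 - \<rho>}"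
      using prob_left_of_S1_0_step[of "\<rho> ^ (2 * Suc k + 2)"] unfolding div q_def .
    also have "\<dots> \<le> p\<^sup>2 * t ^ k + q * ((1 + B) * q ^ k - B * t ^ k)"
      using prob_left_of_1[of k] Suc q unfolding t_def[symmetric]
      by (intro add_mono mult_left_mono) auto
    also have "\<dots> = (1 + B) * q ^ Suc k + (p\<^sup>2 - B * q) * t ^ k" by (simp add: algebra_simps)
    also have "p\<^sup>2 - B * q = - (B * t)" using B(2) by simp
    finally show ?case by (simp add: mult.assoc)
  qed
  have "prob {1 - \<rho> - \<rho> ^ (2 * k + 2)<..<1 - \<rho>} \<le> (1 + B) * q ^ k" for k
    using bound[of k] mult_nonneg_nonneg[OF B(1) zero_le_power[OF t, of k]] by linarith
  then show ?thesis using B(1) unfolding q_def by (intro exI[of _ "1 + B"]) auto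
qed

section \<open>The upper quasi-Assouad dimension\<close>

text \<open>
  The test balls have centre \<open>1 - \<rho> - R / 2\<close>, with \<open>R = \<rho>\<^sup>2\<^sup>k\<^sup>+\<^sup>2\<close>. The smaller radius is at
  most \<open>R / 2\<close>, which keeps the small ball on the light side of \<open>1 - \<rho>\<close>, while the large one
  reaches \<open>R / 2\<close> into the heavy side.
\<close>
lemma admissible_exponent_ge:
  assumes C1: "0 < C1" and C2: "0 < C2" and c: "0 < c"
    and adm: "\<forall>r R x.
     R \<in> {0<..<1} \<and> 0 < r \<and> r < R powr (1 + c) \<and> R powr (1 + c) \<le> R \<and> R \<le> C1 \<and>
     x \<in> measure_support \<mu> \<longrightarrow>
     prob (ball x R) / prob (ball x r) \<le> C2 * (R / r) powr \<alpha>"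
  shows "ln (p / (1 - p)) / (2 * ln (1 / \<rho>)) / c \<le> \<alpha>"
proof -
  obtain A where A: "0 < A"
      "\<And>k. prob {1 - \<rho> - \<rho> ^ (2 * k + 2)<..<1 - \<rho>} \<le> A * (p * (1 - p)) ^ k"
    using prob_left_of_S1_0 by blast
  define b where "b = \<rho> powr (- 2 * \<alpha> * c)"
  define D where "D = C2 * 2 powr \<alpha> * b"
  define g where "g = (1 - p) * p ^ 3 / A"
  have g: "0 < g" using A(1) bias by (simp add: g_def)
  have b: "0 < b" using rho_pos by (simp add: b_def)
  have main: "g * (p / (1 - p)) ^ k \<le> D * b ^ k" if k: "\<rho> ^ k \<le> C1" for k
  proof -
    define R where "R = \<rho> ^ (2 * k + 2)"
    define r where "r = R powr (1 + c) / 2"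
    define x where "x = 1 - \<rho> - R / 2"
    have R: "0 < R" "R \<le> \<rho>\<^sup>2"
      unfolding R_def using rho_pos rho_less_1 by (simp, intro power_decreasing) auto
    have R1: "R < 1" using R rho by simp
    have RC: "R \<le> C1"
    proof -
      have "R \<le> \<rho> ^ k" unfolding R_def using rho_pos rho_less_1 by (intro power_decreasing) auto
      then show ?thesis using k by simp
    qed
    have Rc: "R powr (1 + c) \<le> R"
      using R(1) R1 c powr_mono'[of 1 "1 + c" R] by simp
    have r: "0 < r" "r < R powr (1 + c)" "r \<le> R / 2" using R(1) Rc by (auto simp: r_def)
    have x: "x \<in> measure_support \<mu>"
      unfolding support x_def using R rho by auto
    have ratio: "prob (ball x R) / prob (ball x r) \<le> C2 * (R / r) powr \<alpha>"
      using adm R R1 r Rc RC x by auto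
    \<comment> \<open>The quotient would be \<open>0\<close>, not infinite, if the small ball were null.\<close>
    have rpos: "0 < prob (ball x r)"
      using x r(1) unfolding measure_support_def
      by (auto simp: emeasure_eq_measure dest!: spec[of _ "ball x r"])
    have "prob (ball x r) \<le> prob {1 - \<rho> - \<rho> ^ (2 * k + 2)<..<1 - \<rho>}"
      using r unfolding R_def[symmetric]
      by (intro prob_mono) (auto simp: x_def dist_real_def abs_if split: if_splits)
    then have small: "prob (ball x r) \<le> A * (p * (1 - p)) ^ k" using A(2)[of k] by linarith
    \<comment> \<open>Since \<open>\<rho>\<^sup>2 < 1 / 2\<close>, two further contractions bring the scale below \<open>R / 2\<close>.\<close>
    have "\<rho> ^ Suc (2 * k + 3) = R * \<rho>\<^sup>2" by (simp add: R_def power_add[symmetric] numeral_eq_Suc)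
    also have "\<dots> < R * (1/2)" using R rho by (intro mult_strict_left_mono) auto
    finally have lt: "\<rho> ^ Suc (2 * k + 3) < R / 2" by simp
    have "(1 - p) * p ^ (2 * k + 3) \<le> prob {1 - \<rho>..1 - \<rho> + \<rho> ^ Suc (2 * k + 3)}"
      by (rule prob_right_of_S1_0)
    also have "\<dots> \<le> prob (ball x R)"
      using lt R(1) by (intro prob_mono) (auto simp: x_def dist_real_def)
    finally have large: "(1 - p) * p ^ (2 * k + 3) \<le> prob (ball x R)" .
    have "g * (p / (1 - p)) ^ k = ((1 - p) * p ^ (2 * k + 3)) / (A * (p * (1 - p)) ^ k)"
    proof -
      have "p ^ (2 * k + 3) = p ^ 3 * p ^ k * p ^ k"
        unfolding power_add[symmetric] by (rule arg_cong[of _ _ "(^) p"]) simp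
      then show ?thesis
        using A(1) bias unfolding g_def power_mult_distrib power_divide by simp
    qed
    also have "\<dots> \<le> prob (ball x R) / prob (ball x r)"
      using large small rpos bias by (intro frac_le) auto
    also have "\<dots> \<le> C2 * (R / r) powr \<alpha>" by (rule ratio)
    also have "R / r = 2 * R powr (- c)"
      using R(1) by (simp add: r_def powr_add powr_minus field_simps)
    also have "R = \<rho> powr (2 * k + 2)"
      unfolding R_def using powr_realpow[OF rho_pos, of "2 * k + 2"] by (simp add: add_ac)
    also have "C2 * (2 * (\<rho> powr (2 * k + 2)) powr (- c)) powr \<alpha> = D * (\<rho> powr (- 2 * \<alpha> * c)) powr k"
      using rho_pos by (simp add: D_def b_def powr_mult powr_powr powr_add[symmetric] algebra_simps)
    also have "\<dots> = D * b ^ k" using b unfolding b_def[symmetric] by (simp add: powr_realpow)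
    finally show ?thesis .
  qed
  \<comment> \<open>Letting \<open>k\<close> grow compares the bases of the two exponentials in \<open>main\<close>.\<close>
  have "p / (1 - p) \<le> b"
  proof (rule ccontr)
    assume "\<not> p / (1 - p) \<le> b"
    then have gt: "1 < p / (1 - p) / b" using pos_less_divide_eq[OF b, of 1 "p / (1 - p)"] by simp
    have "(\<lambda>k. D / (p / (1 - p) / b) ^ k) \<longlonglongrightarrow> 0"
      by (rule LIMSEQ_divide_realpow_zero[OF gt])
    then have 1: "\<forall>\<^sub>F k in sequentially. D / (p / (1 - p) / b) ^ k < g"
      using g by (rule order_tendstoD(2))
    have "(\<lambda>k. \<rho> ^ k) \<longlonglongrightarrow> 0" using rho_pos rho_less_1 by (intro LIMSEQ_power_zero) auto
    then have 2: "\<forall>\<^sub>F k in sequentially. \<rho> ^ k < C1" using C1 by (rule order_tendstoD(2))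
    obtain k where k: "D / (p / (1 - p) / b) ^ k < g" "\<rho> ^ k < C1"
      using eventually_happens[OF eventually_conj[OF 1 2]] by auto
    have "D * b ^ k < g * (p / (1 - p)) ^ k"
    proof -
      have "0 < (p / (1 - p)) ^ k" using bias by simp
      moreover have "D * b ^ k / (p / (1 - p)) ^ k < g"
        using k(1) unfolding power_divide[of "p / (1 - p)"] by simp
      ultimately show ?thesis by (simp only: pos_divide_less_eq)
    qed
    then show False using main[of k] k(2) by simp
  qed
  then have "ln (p / (1 - p)) \<le> ln b" using bias b by simp
  also have "ln b = \<alpha> * c * (2 * ln (1 / \<rho>))"
    using rho_pos by (simp add: b_def ln_powr ln_div)
  finally have "ln (p / (1 - p)) \<le> \<alpha> * c * (2 * ln (1 / \<rho>))" .
  moreover have "0 < 2 * ln (1 / \<rho>)" using rho_pos rho_less_1 by simp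
  ultimately show ?thesis using c by (simp add: pos_divide_le_eq mult_ac)
qed

lemma upper_Phi_dim_ge:
  assumes "0 < c"
  shows "ereal (ln (p / (1 - p)) / (2 * ln (1 / \<rho>)) / c) \<le> upper_Phi_dim (\<lambda>_. c) \<mu>"
  unfolding upper_Phi_dim_def
proof (rule Inf_greatest)
  fix y assume "y \<in> ereal ` {\<alpha>. \<exists>C1>0. \<exists>C2>0. \<forall>r R x.
     R \<in> {0<..<1} \<and> 0 < r \<and> r < R powr (1 + c) \<and> R powr (1 + c) \<le> R \<and> R \<le> C1 \<and>
     x \<in> measure_support \<mu> \<longrightarrow>
     measure \<mu> (ball x R) / measure \<mu> (ball x r) \<le> C2 * (R / r) powr \<alpha>}"
  then obtain \<alpha> C1 C2 where "y = ereal \<alpha>" "0 < C1" "0 < C2" "\<forall>r R x.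
     R \<in> {0<..<1} \<and> 0 < r \<and> r < R powr (1 + c) \<and> R powr (1 + c) \<le> R \<and> R \<le> C1 \<and>
     x \<in> measure_support \<mu> \<longrightarrow>
     measure \<mu> (ball x R) / measure \<mu> (ball x r) \<le> C2 * (R / r) powr \<alpha>"
    by blast
  with admissible_exponent_ge[OF _ _ assms]
  show "ereal (ln (p / (1 - p)) / (2 * ln (1 / \<rho>)) / c) \<le> y" by simp
qed

lemma upper_qA_dim_infinite: "upper_qA_dim \<mu> = \<infinity>"
proof -
  define \<kappa> where "\<kappa> = ln (p / (1 - p)) / (2 * ln (1 / \<rho>))"
  have \<kappa>: "0 < \<kappa>" using bias rho_pos rho_less_1 by (auto simp: \<kappa>_def intro!: divide_pos_pos)
  have "((\<lambda>\<theta>::real. 1 / \<theta> - 1) \<longlongrightarrow> 1 / 1 - 1) (at_left 1)"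
    by (intro tendsto_intros) auto
  moreover have pos: "\<forall>\<^sub>F \<theta>::real in at_left 1. 0 < 1 / \<theta> - 1"
    by (rule eventually_at_leftI[of 0]) (auto simp: field_simps)
  ultimately have "filterlim (\<lambda>\<theta>::real. 1 / \<theta> - 1) (at_right 0) (at_left 1)"
    by (intro tendsto_imp_filterlim_at_right) auto
  then have "filterlim (\<lambda>\<theta>::real. \<kappa> * inverse (1 / \<theta> - 1)) at_top (at_left 1)"
    by (intro filterlim_tendsto_pos_mult_at_top[OF tendsto_const \<kappa>]
        filterlim_compose[OF filterlim_inverse_at_top_right])
  then have "((\<lambda>\<theta>. ereal (\<kappa> * inverse (1 / \<theta> - 1))) \<longlongrightarrow> \<infinity>) (at_left 1)"
    by (simp add: tendsto_PInfty filterlim_at_top_dense)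
  moreover have "\<forall>\<^sub>F \<theta> in at_left 1. ereal (\<kappa> * inverse (1 / \<theta> - 1)) \<le> upper_Phi_dim (\<lambda>_. 1 / \<theta> - 1) \<mu>"
    using pos
  proof eventually_elim
    case (elim \<theta>)
    then show ?case using upper_Phi_dim_ge[OF elim] unfolding \<kappa>_def[symmetric] by (simp only: divide_inverse)
  qed
  ultimately have "\<infinity> \<le> upper_qA_dim \<mu>"
    by (rule tendsto_le[OF trivial_limit_at_left_real tendsto_upper_qA_dim])
  then show ?thesis by simp
qed

end

theorem proposition3p9:
  fixes \<rho> p :: real and \<mu> :: "real measure" and S :: "nat \<Rightarrow> real \<Rightarrow> real" and P :: "nat \<Rightarrow> real"
  assumes "\<rho> = (sqrt 5 - 1) / 2"
    and "1 / 2 < p" and "p < 1"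
    and "S 0 = (\<lambda>x. \<rho> * x)" and "S 1 = (\<lambda>x. \<rho> * x + 1 - \<rho>)"
    and "P 0 = p" and "P 1 = 1 - p"
    and "prob_space \<mu>" and "sets \<mu> = sets borel"
    and "\<forall>E\<in>sets borel. measure \<mu> E = p * measure \<mu> (S 0 -` E) + (1 - p) * measure \<mu> (S 1 -` E)"
  shows "equicontractive_ifs {0, 1} S \<rho>
    \<and> self_similar_measure {0, 1} S P \<mu>
    \<and> finite_type {0, 1} S \<rho>
    \<and> measure_support \<mu> = {0..1}
    \<and> upper_qA_dim \<mu> = \<infinity>"
proof -
  interpret prob_space \<mu> by fact
  interpret biased_golden_convolution \<mu> \<rho> p
    using assms by unfold_locales auto
  have "self_similar_measure {0, 1} S P \<mu>"
    unfolding self_similar_measure_def using assms by simp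
  then show ?thesis
    using golden_ifs_equicontractive golden_ifs_finite_type support upper_qA_dim_infinite assms
    by blast
qed

end
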